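(* Let $\mu=\sum_{i=1}^{M}w_i\mu^{(i)}$ be a mixture of probability measures on $\mathbb{R}^d$, with $w_i>0$ and $\sum_i w_i=1$, where $\mu$ has density proportional to $e^{-g}$ and each $\mu^{(i)}$ has density proportional to $e^{-g_i}$. Let $\mathscr{L}$ be the generator of Langevin diffusion with stationary measure $\mu$ and $\mathscr{L}_i$ the generator of Langevin diffusion with stationary measure $\mu^{(i)}$. Then $$\langle f,\mathscr{L}f\rangle_{\mu}=\sum_{i=1}^{M}w_i\langle f,\mathscr{L}_i f\rangle_{\mu^{(i)}} .$$
   Context: Langevin diffusion with stationary density proportional to $e^{-g}$ on $\mathbb{R}^d$ is the solution of $dX_t=-\nabla g(X_t)\,dt+\sqrt2\,dW_t$ with $W$ a Brownian motion; its generator is $\mathscr{L}f=\Delta f-\langle\nabla g,\nabla f\rangle$. $\langle f,h\rangle_\mu=\int fh\,d\mu$. The potentials $g,g_i$ are assumed regular enough for these diffusions to be defined, and $f$ ranges over test functions (e.g. $C_c^\infty(\mathbb{R}^d)$) for which integration by parts is valid. *)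

theory Defs
  imports "HOL-Probability.Probability"
begin

definition partial_deriv :: "'a \<Rightarrow> ('a::euclidean_space \<Rightarrow> real) \<Rightarrow> 'a \<Rightarrow> real" where
  "partial_deriv b f x = frechet_derivative f (at x) b"

definition grad :: "('a::euclidean_space \<Rightarrow> real) \<Rightarrow> 'a \<Rightarrow> 'a" where
  "grad f x = (\<Sum>b\<in>Basis. partial_deriv b f x *\<^sub>R b)"

definition laplacian :: "('a::euclidean_space \<Rightarrow> real) \<Rightarrow> 'a \<Rightarrow> real" where
  "laplacian f x = (\<Sum>b\<in>Basis. partial_deriv b (partial_deriv b f) x)"

text \<open>Differentiability is required explicitly because \<open>frechet_derivative\<close> is an arbitrary
  choice at points where the derivative does not exist.\<close>

fun C_k :: "nat \<Rightarrow> ('a::euclidean_space \<Rightarrow> real) \<Rightarrow> bool" where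
  "C_k 0 f \<longleftrightarrow> continuous_on UNIV f"
| "C_k (Suc k) f \<longleftrightarrow> (\<forall>x. f differentiable at x) \<and> (\<forall>b\<in>Basis. C_k k (partial_deriv b f))"

definition test_functions :: "('a::euclidean_space \<Rightarrow> real) set" where
  "test_functions = {f. (\<forall>k. C_k k f) \<and> compact (closure {x. f x \<noteq> 0})}"

text \<open>The generator of the diffusion \<open>dX = - grad g(X) dt + sqrt 2 dW\<close>, given by its
  differential expression.  It depends on the potential only through its gradient, so the
  unspecified normalising constant in \<open>gibbs_measure\<close> does not matter.\<close>

definition langevin_generator ::
    "('a::euclidean_space \<Rightarrow> real) \<Rightarrow> ('a \<Rightarrow> real) \<Rightarrow> 'a \<Rightarrow> real" where
  "langevin_generator g f x = laplacian f x - grad g x \<bullet> grad f x"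

definition gibbs_measure :: "'a::euclidean_space measure \<Rightarrow> ('a \<Rightarrow> real) \<Rightarrow> bool" where
  "gibbs_measure \<mu> g \<longleftrightarrow> prob_space \<mu> \<and>
     (\<exists>c>0. \<mu> = density lborel (\<lambda>x. ennreal (c * exp (- g x))))"

definition is_mixture ::
    "'a::euclidean_space measure \<Rightarrow> 'i set \<Rightarrow> ('i \<Rightarrow> real) \<Rightarrow> ('i \<Rightarrow> 'a measure) \<Rightarrow> bool" where
  "is_mixture \<mu> I w \<nu> \<longleftrightarrow> sets \<mu> = sets borel \<and>
     (\<forall>A\<in>sets borel. emeasure \<mu> A = (\<Sum>i\<in>I. ennreal (w i) * emeasure (\<nu> i) A))"

definition L2_inner :: "'a measure \<Rightarrow> ('a \<Rightarrow> real) \<Rightarrow> ('a \<Rightarrow> real) \<Rightarrow> real" where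
  "L2_inner \<mu> f h = (\<integral>x. f x * h x \<partial>\<mu>)"

end

theory Submission
  imports Defs
begin

text \<open>The identity holds already under the integral sign, without integration by parts. Two
  continuous densities of the same measure agree everywhere, so \<open>p = \<Sum>i. w i * p i\<close> for the
  densities \<open>p = c * exp (- g)\<close> and \<open>p i = c i * exp (- gi i)\<close>. Differentiating and using
  \<open>grad p = - p * grad g\<close> gives \<open>p * grad g = \<Sum>i. w i * p i * grad (gi i)\<close>, whence
  \<open>p * L f = \<Sum>i. w i * p i * L i f\<close> pointwise.\<close>

text \<open>The set where \<open>p\<close> and \<open>q\<close> differ is open by continuity and
  null by assumption, and a nonempty open set is never negligible.\<close>

lemma AE_lborel_eq_continuous_imp_eq:
  fixes p q :: "'a::euclidean_space \<Rightarrow> 'b::real_normed_vector"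
  assumes "continuous_on UNIV p" "continuous_on UNIV q" and ae: "AE x in lborel. p x = q x"
  shows "p x = q x"
proof -
  have op: "open {x. p x \<noteq> q x}"
    using assms by (intro open_Collect_neq)
  \<comment> \<open>\<open>negligible\<close> refers to null sets of \<open>lebesgue\<close>, the
    completion of \<open>lborel\<close>.\<close>
  have "AE x in lebesgue. p x = q x"
    using ae by (rule AE_completion)
  then have "negligible {x. p x \<noteq> q x}"
    using op by (simp add: negligible_iff_null_sets AE_iff_null_sets borel_open)
  with open_not_negligible[OF op] have "{x. p x \<noteq> q x} = {}" by blast
  then show ?thesis by blast
qed

lemma integrable_lborel_compact_support:
  fixes h :: "'a::euclidean_space \<Rightarrow> real"
  assumes "continuous_on UNIV h" "compact K" "\<And>x. x \<notin> K \<Longrightarrow> h x = 0"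
  shows "integrable lborel h"
proof -
  have "integrable lborel (\<lambda>x. indicator K x *\<^sub>R h x)"
    using assms by (intro borel_integrable_compact) (auto intro: continuous_on_subset)
  moreover have "(\<lambda>x. indicator K x *\<^sub>R h x) = h"
    using assms(3) by (force simp: indicator_def)
  ultimately show ?thesis by simp
qed

lemma C_k_Suc_imp_continuous_on:
  "C_k (Suc k) f \<Longrightarrow> continuous_on UNIV f"
  by (auto intro!: differentiable_imp_continuous_on simp: differentiable_on_def)

lemma continuous_on_grad:
  "C_k 1 f \<Longrightarrow> continuous_on UNIV (grad f)"
  unfolding grad_def [abs_def] by (intro continuous_intros) simp

lemma continuous_on_laplacian:
  "C_k 2 f \<Longrightarrow> continuous_on UNIV (laplacian f)"
  unfolding laplacian_def [abs_def] by (intro continuous_on_sum) (simp add: numeral_2_eq_2)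

lemma continuous_on_langevin_generator:
  assumes "C_k 1 g" "f \<in> test_functions"
  shows "continuous_on UNIV (langevin_generator g f)"
  unfolding langevin_generator_def [abs_def] using assms
  by (intro continuous_intros continuous_on_laplacian continuous_on_grad)
     (auto simp: test_functions_def)

text \<open>Kept as a Frechet derivative rather than a formula for \<open>grad\<close>, so that
  uniqueness of derivatives can be applied to the whole mixture.\<close>

lemma has_derivative_gibbs_density:
  assumes "C_k 1 g"
  shows "((\<lambda>x. c * exp (- g x)) has_derivative
      (\<lambda>h. - (c * exp (- g x) * frechet_derivative g (at x) h))) (at x)"
proof -
  have "(g has_derivative frechet_derivative g (at x)) (at x)"
    using assms by (auto simp: frechet_derivative_works[symmetric])
  then show ?thesis
    by (auto intro!: derivative_eq_intros)
qed

context
  fixes I :: "'i set" and w c :: "'i \<Rightarrow> real" and gi :: "'i \<Rightarrow> 'a::euclidean_space \<Rightarrow> real"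
    and g :: "'a \<Rightarrow> real" and c0 :: real
  assumes g: "C_k 1 g" and gi: "\<And>i. i \<in> I \<Longrightarrow> C_k 1 (gi i)"
    and eq: "\<And>x. c0 * exp (- g x) = (\<Sum>i\<in>I. w i * (c i * exp (- gi i x)))"
begin

text \<open>By \<open>eq\<close>, both sides are, up to sign, the gradient of one and the same
  function.\<close>

lemma grad_mixture_density:
  "(c0 * exp (- g x)) *\<^sub>R grad g x = (\<Sum>i\<in>I. (w i * (c i * exp (- gi i x))) *\<^sub>R grad (gi i) x)"
proof -
  have "((\<lambda>x. \<Sum>i\<in>I. w i * (c i * exp (- gi i x))) has_derivative
      (\<lambda>h. \<Sum>i\<in>I. w i * - (c i * exp (- gi i x) * frechet_derivative (gi i) (at x) h))) (at x)"
    using gi by (intro has_derivative_sum has_derivative_mult_right has_derivative_gibbs_density)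
  then have "(\<lambda>h. - (c0 * exp (- g x) * frechet_derivative g (at x) h)) =
      (\<lambda>h. \<Sum>i\<in>I. w i * - (c i * exp (- gi i x) * frechet_derivative (gi i) (at x) h))"
    using has_derivative_gibbs_density[OF g, of c0 x]
    by (intro has_derivative_unique[of "\<lambda>x. c0 * exp (- g x)"]) (simp_all only: eq)
  \<comment> \<open>Evaluating the two equal linear maps at \<open>b\<close> gives the partial
    derivatives; the minus signs cancel.\<close>
  from fun_cong[OF this] have "c0 * exp (- g x) * partial_deriv b g x =
      (\<Sum>i\<in>I. w i * (c i * exp (- gi i x)) * partial_deriv b (gi i) x)" for b
    by (simp add: partial_deriv_def sum_negf mult.assoc)
  then show ?thesis
    unfolding grad_def
    by (simp add: scaleR_sum_right scaleR_sum_left) (rule sum.swap)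
qed

text \<open>The Laplacian of \<open>f\<close> is the same for every potential, so that term is
  \<open>eq\<close> multiplied by it; the drift term is \<open>grad_mixture_density\<close> paired
  with \<open>grad f x\<close>.\<close>

lemma langevin_generator_mixture_density:
  "c0 * exp (- g x) * langevin_generator g f x =
    (\<Sum>i\<in>I. w i * (c i * exp (- gi i x)) * langevin_generator (gi i) f x)"
proof -
  have "c0 * exp (- g x) * (grad g x \<bullet> grad f x) =
      (\<Sum>i\<in>I. w i * (c i * exp (- gi i x)) * (grad (gi i) x \<bullet> grad f x))"
    using arg_cong[OF grad_mixture_density, of "\<lambda>v. v \<bullet> grad f x" x]
    by (simp add: inner_sum_left)
  then show ?thesis
    unfolding langevin_generator_def
    by (simp add: right_diff_distrib sum_subtractf eq flip: sum_distrib_right)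
qed

end

text \<open>The weighted sum of the \<open>q i\<close> is also a density of \<open>\<mu>\<close>.
  Densities with respect to \<open>lborel\<close> are unique almost everywhere, and continuity
  removes the exceptional set.\<close>

lemma is_mixture_density_eq:
  fixes p :: "'a::euclidean_space \<Rightarrow> real"
  assumes I: "finite I" and mix: "is_mixture \<mu> I w \<nu>"
    and w: "\<And>i. i \<in> I \<Longrightarrow> 0 \<le> w i"
    and \<mu>: "\<mu> = density lborel (\<lambda>x. ennreal (p x))"
    and \<nu>: "\<And>i. i \<in> I \<Longrightarrow> \<nu> i = density lborel (\<lambda>x. ennreal (q i x))"
    and p: "continuous_on UNIV p" "\<And>x. 0 \<le> p x"
    and q: "\<And>i. i \<in> I \<Longrightarrow> continuous_on UNIV (q i)" "\<And>i x. i \<in> I \<Longrightarrow> 0 \<le> q i x"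
  shows "p x = (\<Sum>i\<in>I. w i * q i x)"
proof -
  note [measurable] = borel_measurable_continuous_onI[OF p(1)]
  have qm [measurable]: "q i \<in> borel_measurable borel" if "i \<in> I" for i
    using q(1)[OF that] by (rule borel_measurable_continuous_onI)
  have "\<mu> = density lborel (\<lambda>x. ennreal (\<Sum>i\<in>I. w i * q i x))"
  proof (rule measure_eqI)
    fix A assume "A \<in> sets \<mu>"
    then have A [measurable]: "A \<in> sets borel"
      using mix by (simp add: is_mixture_def)
    have "emeasure \<mu> A = (\<Sum>i\<in>I. ennreal (w i) * emeasure (\<nu> i) A)"
      using mix A by (simp add: is_mixture_def)
    also have "\<dots> = (\<Sum>i\<in>I. \<integral>\<^sup>+x. ennreal (w i) * (ennreal (q i x) * indicator A x) \<partial>lborel)"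
      by (intro sum.cong refl) (simp add: \<nu> emeasure_density nn_integral_cmult)
    also have "\<dots> = (\<integral>\<^sup>+x. (\<Sum>i\<in>I. ennreal (w i) * (ennreal (q i x) * indicator A x)) \<partial>lborel)"
      by (intro nn_integral_sum[symmetric]) simp
    also have "\<dots> = (\<integral>\<^sup>+x. ennreal (\<Sum>i\<in>I. w i * q i x) * indicator A x \<partial>lborel)"
      using w q(2)
      by (intro nn_integral_cong)
         (simp add: sum_distrib_right ennreal_mult mult.assoc flip: sum_ennreal)
    also have "\<dots> = emeasure (density lborel (\<lambda>x. ennreal (\<Sum>i\<in>I. w i * q i x))) A"
      by (intro emeasure_density[symmetric]) auto
    finally show "emeasure \<mu> A = \<dots>" .
  qed (simp add: \<mu>)
  then have "AE x in lborel. ennreal (p x) = ennreal (\<Sum>i\<in>I. w i * q i x)"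
    unfolding \<mu> by (intro sigma_finite_measure.density_unique[OF lborel.sigma_finite_measure_axioms]) auto
  \<comment> \<open>Both sides are nonnegative, so \<open>ennreal\<close> is injective on
    them.\<close>
  then have "AE x in lborel. p x = (\<Sum>i\<in>I. w i * q i x)"
    using p(2) w q(2) by (auto elim!: eventually_mono simp: sum_nonneg)
  then show ?thesis
    by (rule AE_lborel_eq_continuous_imp_eq[rotated 2])
       (use p(1) q(1) in \<open>auto intro!: continuous_intros\<close>)
qed

text \<open>The density is grouped with \<open>h\<close> because the product of density and
  generator is what the pointwise mixture identity rewrites.\<close>

lemma L2_inner_density:
  fixes f h p :: "'a::euclidean_space \<Rightarrow> real"
  assumes "continuous_on UNIV f" "continuous_on UNIV h" "continuous_on UNIV p" "\<And>x. 0 \<le> p x"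
  shows "L2_inner (density lborel (\<lambda>x. ennreal (p x))) f h = (\<integral>x. f x * (p x * h x) \<partial>lborel)"
proof -
  note [measurable] = assms(1-3)[THEN borel_measurable_continuous_onI]
  show ?thesis
    unfolding L2_inner_def by (subst integral_density) (auto simp: assms(4) mult.left_commute)
qed

theorem proposition6:
  fixes m :: nat and w :: "nat \<Rightarrow> real"
    and \<mu> :: "'a::euclidean_space measure" and \<mu>i :: "nat \<Rightarrow> 'a measure"
    and g :: "'a \<Rightarrow> real" and gi :: "nat \<Rightarrow> 'a \<Rightarrow> real" and f :: "'a \<Rightarrow> real"
  assumes "\<And>i. i \<in> {1..m} \<Longrightarrow> w i > 0"
    and "(\<Sum>i=1..m. w i) = 1"
    and "is_mixture \<mu> {1..m} w \<mu>i"
    and "gibbs_measure \<mu> g"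
    and "\<And>i. i \<in> {1..m} \<Longrightarrow> gibbs_measure (\<mu>i i) (gi i)"
    and "C_k 1 g"
    and "\<And>i. i \<in> {1..m} \<Longrightarrow> C_k 1 (gi i)"
    and "f \<in> test_functions"
  shows "L2_inner \<mu> f (langevin_generator g f) =
    (\<Sum>i=1..m. w i * L2_inner (\<mu>i i) f (langevin_generator (gi i) f))"
proof -
  note w = assms(1) and g = assms(6) and gi = assms(7) and f = assms(8)
  obtain c0 where c0: "c0 > 0" "\<mu> = density lborel (\<lambda>x. ennreal (c0 * exp (- g x)))"
    using assms(4) by (auto simp: gibbs_measure_def)
  have "\<forall>i\<in>{1..m}. \<exists>c>0. \<mu>i i = density lborel (\<lambda>x. ennreal (c * exp (- gi i x)))"
    using assms(5) by (auto simp: gibbs_measure_def)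
  then obtain c where c: "\<And>i. i \<in> {1..m} \<Longrightarrow> c i > 0"
      "\<And>i. i \<in> {1..m} \<Longrightarrow> \<mu>i i = density lborel (\<lambda>x. ennreal (c i * exp (- gi i x)))"
    by metis
  have cont: "continuous_on UNIV (\<lambda>x. a * exp (- h x))" if "C_k 1 h" for a and h :: "'a \<Rightarrow> real"
    using C_k_Suc_imp_continuous_on[of 0 h] that by (intro continuous_intros) simp
  have contf: "continuous_on UNIV f"
    using f C_k_Suc_imp_continuous_on[of 0 f] unfolding test_functions_def by blast
  have eq: "c0 * exp (- g x) = (\<Sum>i\<in>{1..m}. w i * (c i * exp (- gi i x)))" for x
    using w c0(1) c(1) g gi
    by (intro is_mixture_density_eq[OF _ assms(3) _ c0(2) c(2)] cont) (auto intro: less_imp_le)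
  \<comment> \<open>Stated for a general potential \<open>h\<close> and constant \<open>a\<close>,
    to serve both \<open>\<mu>\<close> and every component.\<close>
  have inner: "L2_inner (density lborel (\<lambda>x. ennreal (a * exp (- h x)))) f (langevin_generator h f) =
      (\<integral>x. f x * (a * exp (- h x) * langevin_generator h f x) \<partial>lborel)"
    if "C_k 1 h" "a > 0" for a h
    using that f by (intro L2_inner_density cont contf continuous_on_langevin_generator) auto
  \<comment> \<open>Needed to exchange sum and integral: the integrand is continuous, and the factor
    \<open>f\<close> confines it to a compact set.\<close>
  have int: "integrable lborel (\<lambda>x. f x * (c i * exp (- gi i x) * langevin_generator (gi i) f x))"
    if "i \<in> {1..m}" for i
  proof (rule integrable_lborel_compact_support[where K = "closure {x. f x \<noteq> 0}"])
    show "continuous_on UNIV (\<lambda>x. f x * (c i * exp (- gi i x) * langevin_generator (gi i) f x))"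
      using f by (intro continuous_on_mult cont contf continuous_on_langevin_generator gi[OF that])
    show "compact (closure {x. f x \<noteq> 0})"
      using f by (simp add: test_functions_def)
    show "f x * (c i * exp (- gi i x) * langevin_generator (gi i) f x) = 0"
      if "x \<notin> closure {x. f x \<noteq> 0}" for x
      using that closure_subset[of "{x. f x \<noteq> 0}"] by auto
  qed
  have "L2_inner \<mu> f (langevin_generator g f) =
      (\<integral>x. f x * (c0 * exp (- g x) * langevin_generator g f x) \<partial>lborel)"
    unfolding c0(2) using g c0(1) by (rule inner)
  \<comment> \<open>The integrands already agree at every point, so no derivative has to be moved
    from one factor to another.\<close>
  also have "\<dots> = (\<integral>x. (\<Sum>i=1..m. w i * (f x * (c i * exp (- gi i x) * langevin_generator (gi i) f x))) \<partial>lborel)"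
    by (intro Bochner_Integration.integral_cong refl)
       (simp only: langevin_generator_mixture_density[OF g gi eq] sum_distrib_left, simp only: mult_ac)
  also have "\<dots> = (\<Sum>i=1..m. w i * (\<integral>x. f x * (c i * exp (- gi i x) * langevin_generator (gi i) f x) \<partial>lborel))"
    using int by (subst Bochner_Integration.integral_sum) auto
  also have "\<dots> = (\<Sum>i=1..m. w i * L2_inner (\<mu>i i) f (langevin_generator (gi i) f))"
    by (intro sum.cong refl) (simp add: c gi inner del: One_nat_def)
  finally show ?thesis .
qed

end
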